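(* Let $\mathbf{F}$ be a field and let $\{A,B,C\}$ be a dual $3$-net of order $n$ embedded in the projective plane $PG(2,\mathbf{F})$. If $\mathbf{F}$ has positive characteristic $p$, suppose that $n\le p$. If all points of $C$ lie on a single line, then $A\cup B$ is contained in a conic.
   Context: A dual $3$-net of order $n$ embedded in $PG(2,\mathbf{F})$ is a triple $\{A,B,C\}$ of pairwise disjoint point-sets of $PG(2,\mathbf{F})$, each of size $n$ (called components), such that every line meeting two distinct components meets each of the three components in precisely one point. A conic means the zero set in $PG(2,\mathbf{F})$ of a nonzero homogeneous quadratic polynomial (possibly reducible). *)

theory Defs
  imports "HOL-Analysis.Analysis"
begin

text \<open>Points of $PG(2,F)$ are the 1-dimensional subspaces of $F^3$; a line is the set of points
  contained in a fixed 2-dimensional subspace.\<close>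

type_synonym 'a pg2_point = "('a ^ 3) set"

definition pg2_points :: "'a::field pg2_point set" where
  "pg2_points = {P. vec.subspace P \<and> vec.dim P = 1}"

definition pg2_lines :: "'a::field pg2_point set set" where
  "pg2_lines = {{P \<in> pg2_points. P \<subseteq> L} | L. vec.subspace L \<and> vec.dim L = 2}"

definition dual_3_net ::
    "nat \<Rightarrow> 'a::field pg2_point set \<Rightarrow> 'a pg2_point set \<Rightarrow> 'a pg2_point set \<Rightarrow> bool" where
  "dual_3_net n A B C \<longleftrightarrow>
     A \<subseteq> pg2_points \<and> B \<subseteq> pg2_points \<and> C \<subseteq> pg2_points \<and>
     A \<inter> B = {} \<and> A \<inter> C = {} \<and> B \<inter> C = {} \<and>
     finite A \<and> finite B \<and> finite C \<and>
     card A = n \<and> card B = n \<and> card C = n \<and>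
     (\<forall>l \<in> pg2_lines. \<forall>X \<in> {A, B, C}. \<forall>Y \<in> {A, B, C}.
        X \<noteq> Y \<longrightarrow> l \<inter> X \<noteq> {} \<longrightarrow> l \<inter> Y \<noteq> {} \<longrightarrow>
        (\<forall>Z \<in> {A, B, C}. \<exists>!P. P \<in> l \<inter> Z))"

text \<open>A homogeneous quadratic polynomial in three variables is given by its six coefficients, so
  that nonzero means nonzero as a polynomial; this matters over small fields, where a nonzero
  polynomial may vanish at every vector.\<close>

definition quadratic_form :: "'a::field \<Rightarrow> 'a \<Rightarrow> 'a \<Rightarrow> 'a \<Rightarrow> 'a \<Rightarrow> 'a \<Rightarrow> 'a ^ 3 \<Rightarrow> 'a" where
  "quadratic_form a b c d e f v =
     a * (v $ 1)\<^sup>2 + b * (v $ 2)\<^sup>2 + c * (v $ 3)\<^sup>2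
     + d * (v $ 1) * (v $ 2) + e * (v $ 1) * (v $ 3) + f * (v $ 2) * (v $ 3)"

text \<open>By homogeneity, a form vanishes on all of a 1-dimensional subspace as soon as it vanishes at
  one nonzero vector of it, i.e. at one choice of homogeneous coordinates.\<close>

definition is_conic :: "'a::field pg2_point set \<Rightarrow> bool" where
  "is_conic K \<longleftrightarrow> (\<exists>a b c d e f.
     \<not> (a = 0 \<and> b = 0 \<and> c = 0 \<and> d = 0 \<and> e = 0 \<and> f = 0) \<and>
     K = {P \<in> pg2_points. \<forall>v \<in> P. quadratic_form a b c d e f v = 0})"

end

theory Submission
  imports Defs
begin

text \<open>For \<^term>\<open>n \<ge> 3\<close> make the line carrying \<^term>\<open>C\<close> the line at infinity, so that \<^term>\<open>A\<close> and \<^term>\<open>B\<close>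
  become affine. Projecting from a point of \<^term>\<open>C\<close> sends \<^term>\<open>A\<close> and \<^term>\<open>B\<close> bijectively onto the same
  set of scalars, so the difference of their \<^term>\<open>k\<close>-th power sums, a binary form of degree \<^term>\<open>k\<close> in
  the direction of projection, has \<^term>\<open>n\<close> zeros. For \<^term>\<open>k < n\<close> it vanishes identically, and as the
  binomial coefficients are invertible, every polynomial of degree less than \<^term>\<open>n\<close> has the same sum
  over \<^term>\<open>A\<close> as over \<^term>\<open>B\<close>. Apply this to the product of a conic through five points (three from
  one of the sets, two from the other) with \<^term>\<open>n - 3\<close> lines joining the remaining points in pairs, one
  point being left out: the conic has to pass through that point too.\<close>

section \<open>Lines as kernels of linear forms, points as vectors\<close>

definition lin_form :: "'a::field ^ 3 \<Rightarrow> 'a ^ 3 \<Rightarrow> 'a" where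
  "lin_form l v = (\<Sum>i\<in>UNIV. l $ i * v $ i)"

text \<open>Line coordinates of the join of the points spanned by \<open>v\<close> and
  \<open>w\<close>, over any field.\<close>

definition cross_prod :: "'a::field ^ 3 \<Rightarrow> 'a ^ 3 \<Rightarrow> 'a ^ 3" where
  "cross_prod v w = vector [v $ 2 * w $ 3 - v $ 3 * w $ 2, v $ 3 * w $ 1 - v $ 1 * w $ 3,
     v $ 1 * w $ 2 - v $ 2 * w $ 1]"

definition kernel_points :: "'a::field ^ 3 \<Rightarrow> 'a pg2_point set" where
  "kernel_points l = {P \<in> pg2_points. \<forall>v\<in>P. lin_form l v = 0}"

lemma lin_form_add: "lin_form l (v + w) = lin_form l v + lin_form l w"
  by (simp add: lin_form_def sum.distrib algebra_simps)

lemma lin_form_scale: "lin_form l (c *s v) = c * lin_form l v"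
  by (simp add: lin_form_def sum_distrib_left algebra_simps)

lemma lin_form_0: "lin_form l 0 = 0"
  by (simp add: lin_form_def)

lemma lin_form_cross_prod:
  "lin_form (cross_prod v w) v = 0" "lin_form (cross_prod v w) w = 0"
  by (simp_all add: lin_form_def cross_prod_def sum_3 algebra_simps)

text \<open>A nonzero coordinate \<open>v $ i\<close> fixes the factor as
  \<open>w $ i / v $ i\<close>; the vanishing minors settle the other coordinates.\<close>

lemma cross_prod_eq_0:
  assumes "cross_prod v w = 0" "v \<noteq> 0"
  shows "\<exists>c. w = c *s v"
proof -
  have eq: "v $ 2 * w $ 3 = v $ 3 * w $ 2" "v $ 3 * w $ 1 = v $ 1 * w $ 3"
    "v $ 1 * w $ 2 = v $ 2 * w $ 1"
    using assms(1) by (auto simp: cross_prod_def vec_eq_iff forall_3)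
  obtain i where "v $ i \<noteq> 0"
    using assms(2) by (auto simp: vec_eq_iff)
  then have "w = (w $ i / v $ i) *s v"
    using exhaust_3[of i] eq by (auto simp: vec_eq_iff forall_3 field_simps)
  then show ?thesis by blast
qed

lemma subspace_kernel: "vec.subspace {v. lin_form l v = 0}"
  by (rule vec.subspaceI) (auto simp: lin_form_add lin_form_scale lin_form_0)

lemma lin_form_axis: "lin_form l (axis i 1) = l $ i"
  by (simp add: lin_form_def axis_def if_distrib sum.delta cong: if_cong)

text \<open>A unit vector outside the kernel spans the whole space together with it, so the kernel
  has dimension 3 - 1.\<close>

lemma dim_kernel:
  fixes l :: "'a::field ^ 3"
  assumes "l \<noteq> 0"
  shows "vec.dim {v. lin_form l v = 0} = 2"
proof -
  let ?K = "{v. lin_form l v = 0}"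
  obtain i where i: "l $ i \<noteq> 0"
    using assms by (auto simp: vec_eq_iff)
  let ?e = "axis i 1 :: 'a ^ 3"
  have "v \<in> vec.span (insert ?e ?K)" for v
  proof -
    have "v - (lin_form l v / l $ i) *s ?e \<in> ?K"
      using i lin_form_add[of l "v - (lin_form l v / l $ i) *s ?e" "(lin_form l v / l $ i) *s ?e"]
      by (simp add: lin_form_scale lin_form_axis)
    then show ?thesis
      unfolding vec.span_insert by (auto intro: vec.span_base)
  qed
  then have "vec.span (insert ?e ?K) = UNIV" by auto
  then have "vec.dim (insert ?e ?K) = 3"
    using vec_dim_card[where 'a='a and 'n=3] vec.dim_span[of "insert ?e ?K"] by simp
  moreover have "?e \<notin> vec.span ?K"
    using i by (simp only: vec.span_eq_iff[THEN iffD2, OF subspace_kernel]) (simp add: lin_form_axis)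
  ultimately show ?thesis
    by (simp add: vec.dim_insert)
qed

lemma kernel_points_line:
  assumes "l \<noteq> 0"
  shows "kernel_points l \<in> pg2_lines"
proof -
  have "kernel_points l = {P \<in> pg2_points. P \<subseteq> {v. lin_form l v = 0}}"
    by (auto simp: kernel_points_def)
  then show ?thesis
    using subspace_kernel[of l] dim_kernel[OF assms] unfolding pg2_lines_def by blast
qed

text \<open>The cross product of a basis of the plane gives the form: its kernel contains the plane
  and has the same dimension.\<close>

lemma line_kernel_points:
  assumes "K \<in> pg2_lines"
  shows "\<exists>l. l \<noteq> 0 \<and> K = kernel_points l"
proof -
  obtain L where L: "vec.subspace L" "vec.dim L = 2" "K = {P \<in> pg2_points. P \<subseteq> L}"
    using assms by (auto simp: pg2_lines_def)
  obtain S where S: "S \<subseteq> L" "vec.independent S" "L \<subseteq> vec.span S" "card S = 2"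
    using vec.basis_exists[of L] L(2) by metis
  obtain w1 w2 where w: "S = {w1, w2}" "w1 \<noteq> w2"
    using S(4) card_2_iff by metis
  define l where "l = cross_prod w1 w2"
  have "w1 \<noteq> 0"
    using S(2) w(1) vec.dependent_zero by blast
  have "l \<noteq> 0"
  proof
    assume "l = 0"
    then obtain c where "w2 = c *s w1"
      using cross_prod_eq_0 \<open>w1 \<noteq> 0\<close> unfolding l_def by blast
    then have "w2 \<in> vec.span {w1}"
      by (simp add: vec.span_base vec.span_scale)
    then show False
      using S(2) w vec.independent_insert[of w2 "{w1}"] by (simp add: insert_commute)
  qed
  moreover have "L = {v. lin_form l v = 0}"
  proof (rule vec.subspace_dim_equal[OF L(1) subspace_kernel])
    have "vec.span S \<subseteq> {v. lin_form l v = 0}"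
      by (rule vec.span_minimal[OF _ subspace_kernel]) (auto simp: w l_def lin_form_cross_prod)
    then show "L \<subseteq> {v. lin_form l v = 0}" using S(3) by blast
    show "vec.dim {v. lin_form l v = 0} \<le> vec.dim L"
      using dim_kernel[OF \<open>l \<noteq> 0\<close>] L(2) by simp
  qed
  ultimately show ?thesis
    using L(3) by (auto simp: kernel_points_def)
qed

lemma pg2_point_eq_span:
  assumes "P \<in> pg2_points" "v \<in> P" "v \<noteq> 0"
  shows "P = vec.span {v}"
proof -
  have "vec.span {v} = P"
    using assms vec.span_minimal[of "{v}" P]
    by (intro vec.subspace_dim_equal) (auto simp: pg2_points_def)
  then show ?thesis by simp
qed

lemma pg2_point_nonzero:
  assumes "P \<in> pg2_points"
  obtains v where "v \<in> P" "v \<noteq> 0"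
proof -
  have "\<not> P \<subseteq> {0}"
    using assms vec.dim_subset[of P "{0}"] by (auto simp: pg2_points_def)
  then show ?thesis using that by blast
qed

lemma mem_kernel_points_iff:
  assumes "P \<in> pg2_points" "v \<in> P" "v \<noteq> 0"
  shows "P \<in> kernel_points l \<longleftrightarrow> lin_form l v = 0"
proof -
  have "P \<subseteq> {w. lin_form l w = 0}" if "lin_form l v = 0"
    using that vec.span_minimal[OF _ subspace_kernel, of "{v}" l] pg2_point_eq_span[OF assms]
    by simp
  then show ?thesis
    using assms by (auto simp: kernel_points_def)
qed

lemma pg2_points_eqI:
  assumes "P \<in> pg2_points" "v \<in> P" "Q \<in> pg2_points" "w \<in> Q" "w \<noteq> 0" "w = c *s v"
  shows "P = Q"
proof -
  have "w \<in> P"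
    using assms by (auto simp: pg2_points_def vec.subspace_scale)
  then show ?thesis
    using pg2_point_eq_span[of P w] pg2_point_eq_span[of Q w] assms by simp
qed

lemma cross_prod_points:
  assumes "P \<in> pg2_points" "v \<in> P" "v \<noteq> 0" "Q \<in> pg2_points" "w \<in> Q" "w \<noteq> 0" "P \<noteq> Q"
  shows "cross_prod v w \<noteq> 0"
  using cross_prod_eq_0[of v w] pg2_points_eqI[of P v Q w] assms by blast

lemma lin_form_pivot:
  fixes l v :: "'a::field ^ 3"
  assumes "(UNIV :: 3 set) = {i, j, k}" "i \<noteq> j" "i \<noteq> k" "j \<noteq> k"
  shows "lin_form l v = l $ i * v $ i + l $ j * v $ j + l $ k * v $ k"
  unfolding lin_form_def assms(1) using assms(2-4) by (simp add: add.assoc)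

text \<open>The equation \<open>lin_form l v = 1\<close> can be solved for coordinate
  \<open>i\<close>, which leaves coordinates \<open>j\<close> and \<open>k\<close> as affine
  coordinates off the line \<open>l\<close>.\<close>

lemma pivot_exists:
  fixes l :: "'a::field ^ 3"
  assumes "l \<noteq> 0"
  obtains i j k where "l $ i \<noteq> 0" "(UNIV :: 3 set) = {i, j, k}" "i \<noteq> j" "i \<noteq> k" "j \<noteq> k"
proof -
  obtain i where i: "l $ i \<noteq> 0"
    using assms by (auto simp: vec_eq_iff)
  have "card (UNIV - {i}) = 2"
    by (simp add: card_Diff_singleton)
  then obtain j k where jk: "UNIV - {i} = {j, k}" "j \<noteq> k"
    using card_2_iff by metis
  then have "UNIV = {i, j, k}" "i \<noteq> j" "i \<noteq> k" by auto
  then show ?thesis using that i jk(2) by blast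
qed

text \<open>If neither of two unit vectors, one for each form, works for both forms, then their sum
  does.\<close>

lemma lin_forms_common_nonzero:
  assumes "l \<noteq> 0" "m \<noteq> 0"
  shows "\<exists>v. lin_form l v \<noteq> 0 \<and> lin_form m v \<noteq> 0"
proof -
  obtain i j where "l $ i \<noteq> 0" "m $ j \<noteq> 0"
    using assms by (auto simp: vec_eq_iff)
  then have v: "lin_form l (axis i 1) \<noteq> 0" "lin_form m (axis j 1) \<noteq> 0"
    by (simp_all add: lin_form_axis)
  then show ?thesis
    using lin_form_add[of l "axis i 1" "axis j 1"] lin_form_add[of m "axis i 1" "axis j 1"]
    by (metis add.left_neutral add.right_neutral)
qed

section \<open>Conics spanned by two pairs of lines\<close>

lemma quadratic_form_product:
  "\<exists>a b c d e f. \<forall>v. quadratic_form a b c d e f v = lin_form l v * lin_form m v"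
proof -
  have "quadratic_form (l$1 * m$1) (l$2 * m$2) (l$3 * m$3) (l$1 * m$2 + l$2 * m$1)
      (l$1 * m$3 + l$3 * m$1) (l$2 * m$3 + l$3 * m$2) v = lin_form l v * lin_form m v" for v
    by (simp add: quadratic_form_def lin_form_def sum_3 algebra_simps power2_eq_square)
  then show ?thesis by blast
qed

text \<open>The vector \<open>w\<close> ensures that the coefficients are not all zero, and
  homogeneity carries a zero at one vector over to the whole point.\<close>

lemma conic_through:
  fixes l1 l2 m1 m2 :: "'a::field ^ 3" and s t :: 'a
  defines "q \<equiv> \<lambda>v. s * (lin_form l1 v * lin_form l2 v) + t * (lin_form m1 v * lin_form m2 v)"
  assumes "q w \<noteq> 0" and X: "\<And>P. P \<in> X \<Longrightarrow> P \<in> pg2_points \<and> (\<exists>v\<in>P. v \<noteq> 0 \<and> q v = 0)"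
  shows "\<exists>K. is_conic K \<and> X \<subseteq> K"
proof -
  obtain a b c d e f where 1: "\<And>v. quadratic_form a b c d e f v = lin_form l1 v * lin_form l2 v"
    using quadratic_form_product by metis
  obtain a' b' c' d' e' f' where 2:
      "\<And>v. quadratic_form a' b' c' d' e' f' v = lin_form m1 v * lin_form m2 v"
    using quadratic_form_product by metis
  have "quadratic_form (s*a + t*a') (s*b + t*b') (s*c + t*c') (s*d + t*d') (s*e + t*e') (s*f + t*f') v
      = s * quadratic_form a b c d e f v + t * quadratic_form a' b' c' d' e' f' v" for v
    by (simp add: quadratic_form_def algebra_simps)
  then obtain a b c d e f where q: "\<And>v. quadratic_form a b c d e f v = q v"
    unfolding 1 2 q_def by metis
  have nz: "\<not> (a = 0 \<and> b = 0 \<and> c = 0 \<and> d = 0 \<and> e = 0 \<and> f = 0)"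
    using q[of w] \<open>q w \<noteq> 0\<close> by (auto simp: quadratic_form_def)
  have scale: "q (r *s v) = r\<^sup>2 * q v" for r v
    by (simp add: q_def lin_form_scale algebra_simps power2_eq_square)
  let ?K = "{P \<in> pg2_points. \<forall>v\<in>P. quadratic_form a b c d e f v = 0}"
  have "is_conic ?K"
    unfolding is_conic_def using nz by blast
  moreover have "P \<in> ?K" if P: "P \<in> X" for P
  proof -
    obtain v where v: "P \<in> pg2_points" "v \<in> P" "v \<noteq> 0" "q v = 0"
      using X[OF P] by blast
    have "quadratic_form a b c d e f w = 0" if "w \<in> P" for w
    proof -
      obtain r where "w = r *s v"
        using \<open>w \<in> P\<close> pg2_point_eq_span[OF v(1-3)] by (auto simp: vec.span_singleton)
      then show ?thesis using q scale v(4) by simp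
    qed
    then show ?thesis using v(1) by blast
  qed
  ultimately show ?thesis by blast
qed

section \<open>Binary forms and power sums\<close>

text \<open>A nonzero binary form of degree \<open>k\<close> has at most \<open>k\<close> zeros on
  the projective line, and the pairs \<open>(s d, t d)\<close> are more than \<open>k\<close>
  distinct points of it. The quotient \<open>s d / t d\<close> dehomogenises; the point with
  \<open>t d = 0\<close> is treated apart.\<close>

lemma binary_form_zero:
  fixes c :: "nat \<Rightarrow> 'a::field" and s t :: "'i \<Rightarrow> 'a"
  assumes D: "finite D" "k < card D"
    and nz: "\<And>d. d \<in> D \<Longrightarrow> s d \<noteq> 0 \<or> t d \<noteq> 0"
    and np: "\<And>d e. d \<in> D \<Longrightarrow> e \<in> D \<Longrightarrow> d \<noteq> e \<Longrightarrow> s d * t e \<noteq> s e * t d"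
    and zero: "\<And>d. d \<in> D \<Longrightarrow> (\<Sum>j\<le>k. c j * s d ^ j * t d ^ (k - j)) = 0"
    and j: "j \<le> k"
  shows "c j = 0"
proof -
  define p where "p = (\<Sum>j\<le>k. monom (c j) j)"
  have coeff_p: "coeff p m = (if m \<le> k then c m else 0)" for m
    by (simp add: p_def coeff_sum)
  have deg: "degree p \<le> k"
    by (rule degree_le) (simp add: coeff_p)
  define D0 where "D0 = {d \<in> D. t d \<noteq> 0}"
  have root: "poly p (s d / t d) = 0" if "d \<in> D0" for d
  proof -
    have d: "d \<in> D" "t d \<noteq> 0" using that by (auto simp: D0_def)
    have "t d ^ k * poly p (s d / t d) = (\<Sum>j\<le>k. c j * s d ^ j * t d ^ (k - j))"
      unfolding p_def poly_sum sum_distrib_left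
    proof (rule sum.cong[OF refl])
      fix i assume "i \<in> {..k}"
      then have "t d ^ k = t d ^ i * t d ^ (k - i)"
        by (simp flip: power_add)
      then show "t d ^ k * poly (monom (c i) i) (s d / t d) = c i * s d ^ i * t d ^ (k - i)"
        using d(2) by (simp add: poly_monom field_simps)
    qed
    then show ?thesis using zero[OF d(1)] d(2) by simp
  qed
  have inj: "inj_on (\<lambda>d. s d / t d) D0"
    using np by (auto simp: inj_on_def D0_def field_simps)
  have "p = 0"
  proof (rule ccontr)
    assume "p \<noteq> 0"
    have "card D0 = card ((\<lambda>d. s d / t d) ` D0)"
      using inj by (simp add: card_image)
    also have "\<dots> \<le> card {x. poly p x = 0}"
      using \<open>p \<noteq> 0\<close> root by (intro card_mono poly_roots_finite) auto
    also have "\<dots> \<le> degree p"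
      using \<open>p \<noteq> 0\<close> by (rule card_poly_roots_bound)
    finally have le: "card D0 \<le> degree p" .
    then have "D0 \<noteq> D" using D(2) deg by auto
    \<comment> \<open>The point at infinity \<open>e\<close> is unique. If it occurs, the root count
      forces \<open>degree p = k\<close>, whereas a zero at \<open>e\<close> makes the leading
      coefficient vanish.\<close>
    then obtain e where e: "e \<in> D" "t e = 0" by (auto simp: D0_def)
    have "D \<subseteq> insert e D0"
      using np[OF _ e(1)] e(2) by (force simp: D0_def)
    then have "card D \<le> card (insert e D0)"
      using D(1) by (intro card_mono) (auto simp: D0_def)
    also have "\<dots> \<le> Suc (card D0)"
      using D(1) by (simp add: card_insert_if D0_def)
    finally have "card D \<le> Suc (card D0)" .
    then have "degree p = k" using le deg D(2) by linarith
    moreover have "coeff p (degree p) \<noteq> 0" using \<open>p \<noteq> 0\<close> by simp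
    ultimately have "c k \<noteq> 0" by (simp add: coeff_p)
    have "(\<Sum>j\<le>k. c j * s e ^ j * t e ^ (k - j)) = (\<Sum>j\<in>{k}. c j * s e ^ j * t e ^ (k - j))"
      by (rule sum.mono_neutral_right) (auto simp: e(2))
    then show False
      using zero[OF e(1)] nz[OF e(1)] e(2) \<open>c k \<noteq> 0\<close> by simp
  qed
  then show ?thesis using coeff_p[of j] j by simp
qed

text \<open>A positive characteristic is a prime greater than \<open>k\<close>, so it divides
  neither \<open>fact k\<close> nor the divisor \<open>k choose j\<close> of it.\<close>

lemma of_nat_binomial_neq_0:
  assumes "CHAR('a::field) > 0 \<longrightarrow> k < CHAR('a)" "j \<le> k"
  shows "(of_nat (k choose j) :: 'a) \<noteq> 0"
proof
  assume "(of_nat (k choose j) :: 'a) = 0"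
  then have dvd: "CHAR('a) dvd (k choose j)"
    by (simp add: of_nat_eq_0_iff_char_dvd)
  show False
  proof (cases "CHAR('a) = 0")
    case True
    then show False using dvd assms(2) by simp
  next
    case False
    then have "prime CHAR('a)" using prime_CHAR_semidom by auto
    moreover have "CHAR('a) dvd fact k"
      using dvd binomial_fact_lemma[OF assms(2)] by (metis dvd_mult)
    ultimately show False
      using prime_dvd_fact_iff False assms(1) by fastforce
  qed
qed

text \<open>By the binomial theorem the difference of the two projected power sums is a binary form
  in \<open>(s d, t d)\<close>, whose coefficients are binomial coefficients times differences of
  moments.\<close>

lemma moments_eq:
  fixes x y :: "'p \<Rightarrow> 'a::field" and s t :: "'i \<Rightarrow> 'a"
  assumes D: "finite D" "k < card D"
    and nz: "\<And>d. d \<in> D \<Longrightarrow> s d \<noteq> 0 \<or> t d \<noteq> 0"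
    and np: "\<And>d e. d \<in> D \<Longrightarrow> e \<in> D \<Longrightarrow> d \<noteq> e \<Longrightarrow> s d * t e \<noteq> s e * t d"
    and proj: "\<And>d. d \<in> D \<Longrightarrow>
      (\<Sum>P\<in>A. (s d * x P + t d * y P) ^ k) = (\<Sum>P\<in>B. (s d * x P + t d * y P) ^ k)"
    and char: "CHAR('a) > 0 \<longrightarrow> k < CHAR('a)"
    and j: "j \<le> k"
  shows "(\<Sum>P\<in>A. x P ^ j * y P ^ (k - j)) = (\<Sum>P\<in>B. x P ^ j * y P ^ (k - j))"
proof -
  define M where "M X j = (\<Sum>P\<in>X. x P ^ j * y P ^ (k - j))" for X j
  have expand: "(\<Sum>P\<in>X. (s d * x P + t d * y P) ^ k) =
      (\<Sum>j\<le>k. of_nat (k choose j) * M X j * s d ^ j * t d ^ (k - j))" for X d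
  proof -
    have "(\<Sum>P\<in>X. (s d * x P + t d * y P) ^ k) =
      (\<Sum>j\<le>k. \<Sum>P\<in>X. of_nat (k choose j) * (s d * x P) ^ j * (t d * y P) ^ (k - j))"
      unfolding binomial_ring by (rule sum.swap)
    also have "\<dots> = (\<Sum>j\<le>k. of_nat (k choose j) * M X j * s d ^ j * t d ^ (k - j))"
      unfolding M_def sum_distrib_left sum_distrib_right
      by (intro sum.cong refl) (simp add: power_mult_distrib)
    finally show ?thesis .
  qed
  have "of_nat (k choose j) * (M A j - M B j) = 0"
  proof (rule binary_form_zero[OF D nz np _ j,
        where c = "\<lambda>j. of_nat (k choose j) * (M A j - M B j)"])
    fix d assume "d \<in> D"
    then show "(\<Sum>j\<le>k. of_nat (k choose j) * (M A j - M B j) * s d ^ j * t d ^ (k - j)) = 0"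
      using proj[of d] unfolding expand by (simp add: algebra_simps sum_subtractf)
  qed auto
  then show ?thesis
    using of_nat_binomial_neq_0[OF char j] by (simp add: M_def)
qed

section \<open>Affine point sets with equal moments of degree below \<open>n\<close>\<close>

locale balanced_pair =
  fixes A B :: "'p set" and x y :: "'p \<Rightarrow> 'a::field" and n :: nat
  assumes finite: "finite A" "finite B"
    and card: "card A = n" "card B = n"
    and disjoint: "A \<inter> B = {}"
    and moments: "\<And>i j. i + j < n \<Longrightarrow> (\<Sum>P\<in>A. x P ^ i * y P ^ j) = (\<Sum>P\<in>B. x P ^ i * y P ^ j)"
begin

definition affine_fun :: "('p \<Rightarrow> 'a) \<Rightarrow> bool" where
  "affine_fun g \<longleftrightarrow> (\<exists>a b c. \<forall>P\<in>A \<union> B. g P = a * x P + b * y P + c)"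

text \<open>Replaces the notion of a polynomial of degree at most \<open>k\<close> in
  \<open>x\<close> and \<open>y\<close>: multiplied by the monomials allowed here, such a polynomial
  stays of degree below \<open>n\<close>.\<close>

definition balanced :: "nat \<Rightarrow> ('p \<Rightarrow> 'a) \<Rightarrow> bool" where
  "balanced k f \<longleftrightarrow> (\<forall>i j. i + j + k < n \<longrightarrow>
     (\<Sum>P\<in>A. f P * (x P ^ i * y P ^ j)) = (\<Sum>P\<in>B. f P * (x P ^ i * y P ^ j)))"

lemma balanced_one: "balanced 0 (\<lambda>_. 1)"
  using moments by (simp add: balanced_def)

text \<open>A term of \<open>a * x + b * y + c\<close> raises the degree of the test monomial by at
  most one, which the stricter bound on \<open>i + j\<close> leaves room for.\<close>

lemma balanced_affine:
  assumes f: "balanced k f" and g: "affine_fun g"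
  shows "balanced (Suc k) (\<lambda>P. g P * f P)"
  unfolding balanced_def
proof (intro allI impI)
  fix i j assume ij: "i + j + Suc k < n"
  obtain a b c where abc: "\<And>P. P \<in> A \<union> B \<Longrightarrow> g P = a * x P + b * y P + c"
    using g by (auto simp: affine_fun_def)
  define M where "M X i j = (\<Sum>P\<in>X. f P * (x P ^ i * y P ^ j))" for X i j
  have expand: "(\<Sum>P\<in>X. g P * f P * (x P ^ i * y P ^ j)) =
      a * M X (Suc i) j + b * M X i (Suc j) + c * M X i j" if "X \<subseteq> A \<union> B" for X
    unfolding M_def sum_distrib_left sum.distrib[symmetric]
    using that abc by (intro sum.cong refl) (auto simp: algebra_simps subset_iff)
  have "M A (Suc i) j = M B (Suc i) j" "M A i (Suc j) = M B i (Suc j)" "M A i j = M B i j"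
    using f ij by (auto simp: balanced_def M_def simp del: power_Suc)
  then show "(\<Sum>P\<in>A. g P * f P * (x P ^ i * y P ^ j)) = (\<Sum>P\<in>B. g P * f P * (x P ^ i * y P ^ j))"
    by (simp add: expand)
qed

lemma balanced_prod:
  assumes "finite I" "\<And>i. i \<in> I \<Longrightarrow> affine_fun (g i)"
  shows "balanced (card I) (\<lambda>P. \<Prod>i\<in>I. g i P)"
  using assms by (induction I rule: finite_induct) (simp_all add: balanced_one balanced_affine)

lemma balanced_combine:
  assumes "balanced k f" "balanced k g"
  shows "balanced k (\<lambda>P. s * f P + t * g P)"
  using assms by (simp add: balanced_def distrib_right sum.distrib mult.assoc flip: sum_distrib_left)

text \<open>Matching the points of \<^term>\<open>A\<close> and \<^term>\<open>B\<close> outside the two triples and multiplying \<^term>\<open>q\<close> by the \<^term>\<open>n - 3\<close> joining lines gives a polynomial of degree \<^term>\<open>n - 1\<close> that vanishes on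
  \<^term>\<open>A \<union> B\<close> except possibly at \<^term>\<open>Z\<close>.\<close>

lemma conic_sixth_point:
  assumes lines: "\<And>a b. a \<in> A \<Longrightarrow> b \<in> B \<Longrightarrow>
        affine_fun (g a b) \<and> (\<forall>P\<in>A \<union> B. g a b P = 0 \<longleftrightarrow> P = a \<or> P = b)"
    and triples: "A0 \<subseteq> A" "B0 \<subseteq> B" "card A0 = 3" "card B0 = 3"
    and l: "affine_fun l1" "affine_fun l2" "affine_fun m1" "affine_fun m2"
    and q: "\<And>P. q P = s * (l1 P * l2 P) + t * (m1 P * m2 P)"
    and Z: "Z \<in> A0 \<union> B0"
    and zero: "\<And>P. P \<in> A0 \<union> B0 \<Longrightarrow> P \<noteq> Z \<Longrightarrow> q P = 0"
  shows "q Z = 0"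
proof -
  have fin0: "finite A0" "finite B0"
    using triples finite finite_subset by blast+
  have n: "card (A - A0) = n - 3" "card (B - B0) = n - 3" "3 \<le> n"
    using triples fin0 card finite card_mono[of A A0] by (auto simp: card_Diff_subset)
  then obtain h where h: "bij_betw h (A - A0) (B - B0)"
    using finite finite_same_card_bij[of "A - A0" "B - B0"] by auto
  then have hB: "h a \<in> B - B0" if "a \<in> A - A0" for a
    using that by (auto simp: bij_betw_def)
  define f where "f P = (\<Prod>a\<in>A - A0. g a (h a) P)" for P
  have "balanced (n - 3) f"
    unfolding f_def n(1)[symmetric] using finite lines hB by (intro balanced_prod) auto
  then have "balanced (Suc (Suc (n - 3))) (\<lambda>P. s * (l1 P * (l2 P * f P)) + t * (m1 P * (m2 P * f P)))"
    by (intro balanced_combine balanced_affine l)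
  \<comment> \<open>The degree \<open>Suc (Suc (n - 3))\<close> is \<open>n - 1\<close>, just small
    enough to test against the constant monomial.\<close>
  then have eq: "(\<Sum>P\<in>A. q P * f P) = (\<Sum>P\<in>B. q P * f P)"
    unfolding balanced_def using n(3)
    by (elim allE[of _ 0]) (simp add: q algebra_simps)
  have f0: "f P = 0" if P: "P \<in> A \<union> B" "P \<notin> A0 \<union> B0" for P
  proof -
    obtain a where "a \<in> A - A0" "P = a \<or> P = h a"
      using P h by (auto simp: bij_betw_def)
    then have "g a (h a) P = 0"
      using lines[of a "h a"] hB[of a] P by auto
    then show ?thesis
      unfolding f_def using \<open>a \<in> A - A0\<close> finite by auto
  qed
  \<comment> \<open>A joining line meets \<open>A \<union> B\<close> only in its two ends, and
    neither of them is \<open>Z\<close>.\<close>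
  have "g a (h a) Z \<noteq> 0" if "a \<in> A - A0" for a
  proof -
    have "Z \<noteq> a" "Z \<noteq> h a" "Z \<in> A \<union> B"
      using hB[OF that] that Z triples disjoint by auto
    then show ?thesis
      using lines[of a "h a"] hB[OF that] that by auto
  qed
  then have fZ: "f Z \<noteq> 0"
    unfolding f_def using finite by auto
  have off: "q P * f P = 0" if "P \<in> A \<union> B" "P \<noteq> Z" for P
    using that f0 zero by (cases "P \<in> A0 \<union> B0") auto
  have sum: "(\<Sum>P\<in>X. q P * f P) = (if Z \<in> X then q Z * f Z else 0)"
    if "finite X" "X \<subseteq> A \<union> B" for X
  proof -
    have "(\<Sum>P\<in>X. q P * f P) = (\<Sum>P\<in>X. if Z = P then q P * f P else 0)"
      using that off by (intro sum.cong) auto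
    then show ?thesis using that by simp
  qed
  \<comment> \<open>Exactly one of the two equal sums contains the only term that may be
    nonzero.\<close>
  have "Z \<in> A \<longleftrightarrow> Z \<notin> B"
    using Z triples disjoint by auto
  then have "q Z * f Z = 0"
    using eq finite by (auto simp: sum split: if_splits)
  then show ?thesis using fZ by simp
qed

text \<open>The conic is the member through a third point \<open>a3\<close> of the pencil spanned by
  two line pairs, both of which pass through \<open>a1\<close>, \<open>a2\<close>,
  \<open>b1\<close>, \<open>b2\<close>.\<close>

lemma conic_covers:
  assumes lines: "\<And>a b. a \<in> A \<Longrightarrow> b \<in> B \<Longrightarrow>
        affine_fun (g a b) \<and> (\<forall>P\<in>A \<union> B. g a b P = 0 \<longleftrightarrow> P = a \<or> P = b)"
    and "3 \<le> n"
  obtains a1 a2 b1 b2 s t where "a1 \<in> A" "a2 \<in> A" "a1 \<noteq> a2" "b1 \<in> B" "b2 \<in> B" "b1 \<noteq> b2" "t \<noteq> 0"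
    "\<And>P. P \<in> A \<union> B \<Longrightarrow> s * (g a1 b1 P * g a2 b2 P) + t * (g a1 b2 P * g a2 b1 P) = 0"
proof -
  obtain A3 where "A3 \<subseteq> A" "card A3 = 3"
    using obtain_subset_with_card_n[of 3 A] assms(2) card by metis
  then obtain a1 a2 a3 where a: "a1 \<in> A" "a2 \<in> A" "a3 \<in> A" "a1 \<noteq> a2" "a1 \<noteq> a3" "a2 \<noteq> a3"
    by (auto simp: card_3_iff)
  obtain B3 where "B3 \<subseteq> B" "card B3 = 3"
    using obtain_subset_with_card_n[of 3 B] assms(2) card by metis
  then obtain b1 b2 b3 where b: "b1 \<in> B" "b2 \<in> B" "b3 \<in> B" "b1 \<noteq> b2" "b1 \<noteq> b3" "b2 \<noteq> b3"
    by (auto simp: card_3_iff)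
  have zero_iff: "g a b P = 0 \<longleftrightarrow> P = a \<or> P = b" if "a \<in> A" "b \<in> B" "P \<in> A \<union> B" for a b P
    using lines that by blast
  have ne: "P \<noteq> Q" if "P \<in> A" "Q \<in> B" for P Q
    using that disjoint by blast
  \<comment> \<open>The coefficients are the values at \<open>a3\<close> of the opposite line pairs,
    with one sign changed, so that \<open>q a3 = 0\<close>.\<close>
  define s t where "s = g a1 b2 a3 * g a2 b1 a3" and "t = - (g a1 b1 a3 * g a2 b2 a3)"
  define q where "q P = s * (g a1 b1 P * g a2 b2 P) + t * (g a1 b2 P * g a2 b1 P)" for P
  have "t \<noteq> 0"
    using a b ne[OF a(3) b(1)] ne[OF a(3) b(2)] by (auto simp: t_def zero_iff)
  have "g a b a = 0" "g a b b = 0" if "a \<in> A" "b \<in> B" for a b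
    using lines that by auto
  then have base: "q a1 = 0" "q a2 = 0" "q a3 = 0" "q b1 = 0" "q b2 = 0"
    using a b by (simp_all add: q_def s_def t_def)
  have sixth: "q Z = 0" if "A0 \<subseteq> A" "B0 \<subseteq> B" "card A0 = 3" "card B0 = 3" "Z \<in> A0 \<union> B0"
    "\<And>P. P \<in> A0 \<union> B0 \<Longrightarrow> P \<noteq> Z \<Longrightarrow> q P = 0" for A0 B0 Z
    by (rule conic_sixth_point[OF lines that(1-4) _ _ _ _ q_def that(5,6)])
      (use lines a b in auto)
  \<comment> \<open>With \<open>a1\<close>, \<open>a2\<close>, \<open>a3\<close>, \<open>b1\<close>,
    \<open>b2\<close> on the conic, every further point of \<open>B\<close> is a sixth
    point.\<close>
  have qB: "q Z = 0" if "Z \<in> B" for Z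
  proof (cases "Z = b1 \<or> Z = b2")
    case True then show ?thesis using base by auto
  next
    case False
    show ?thesis
      by (rule sixth[of "{a1, a2, a3}" "{b1, b2, Z}" Z]) (use False that a b base in auto)
  qed
  \<comment> \<open>Now \<open>b3\<close> is on the conic as well and takes over the role of
    \<open>a3\<close> as the fifth point.\<close>
  have qA: "q Z = 0" if "Z \<in> A" for Z
  proof (cases "Z = a1 \<or> Z = a2")
    case True then show ?thesis using base by auto
  next
    case False
    show ?thesis
      by (rule sixth[of "{a1, a2, Z}" "{b1, b2, b3}" Z]) (use False that a b base qB in auto)
  qed
  show ?thesis
  proof (rule that)
    show "s * (g a1 b1 P * g a2 b2 P) + t * (g a1 b2 P * g a2 b1 P) = 0" if "P \<in> A \<union> B" for P
      using that qA qB unfolding q_def by blast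
  qed (use a b \<open>t \<noteq> 0\<close> in simp_all)
qed

end

section \<open>Incidence in the net and degenerate conics\<close>

lemma dual_3_net_line:
  assumes "dual_3_net n A B C" "m \<noteq> 0"
    and "X \<in> {A, B, C}" "Y \<in> {A, B, C}" "X \<inter> Y = {}" "Z \<in> {A, B, C}"
    and "P \<in> X" "P \<in> kernel_points m" "Q \<in> Y" "Q \<in> kernel_points m"
  shows "\<exists>!R. R \<in> Z \<and> R \<in> kernel_points m"
proof -
  have meets: "X \<noteq> Y" "kernel_points m \<inter> X \<noteq> {}" "kernel_points m \<inter> Y \<noteq> {}"
    using assms(5-10) by blast+
  have "\<forall>l\<in>pg2_lines. \<forall>X\<in>{A, B, C}. \<forall>Y\<in>{A, B, C}.
      X \<noteq> Y \<longrightarrow> l \<inter> X \<noteq> {} \<longrightarrow> l \<inter> Y \<noteq> {} \<longrightarrow> (\<forall>Z\<in>{A, B, C}. \<exists>!P. P \<in> l \<inter> Z)"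
    using assms(1) unfolding dual_3_net_def by (elim conjE)
  from this[THEN bspec, OF kernel_points_line[OF assms(2)], THEN bspec, OF assms(3),
      THEN bspec, OF assms(4), rule_format, OF meets assms(6)]
  show ?thesis by (simp add: conj_commute)
qed

lemma sum_image_eq:
  assumes "inj_on u A" "inj_on u B" "u ` A = u ` B"
  shows "(\<Sum>P\<in>A. h (u P)) = (\<Sum>P\<in>B. h (u P))"
  using assms sum.reindex[of u A h] sum.reindex[of u B h] by simp

lemma two_points_line:
  fixes P Q :: "'a::field pg2_point"
  assumes "P \<in> pg2_points" "Q \<in> pg2_points" "P \<noteq> Q"
  obtains l where "l \<noteq> 0" "P \<in> kernel_points l" "Q \<in> kernel_points l"
proof -
  obtain v w where v: "v \<in> P" "v \<noteq> 0" and w: "w \<in> Q" "w \<noteq> 0"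
    using assms pg2_point_nonzero by metis
  show ?thesis
    using that[of "cross_prod v w"] cross_prod_points[OF assms(1) v assms(2) w assms(3)]
      mem_kernel_points_iff[OF assms(1) v] mem_kernel_points_iff[OF assms(2) w]
    by (simp add: lin_form_cross_prod)
qed

text \<open>The conic is the pair of lines \<open>P1 Q1\<close> and \<open>P2 Q2\<close>. This
  settles orders 1 and 2.\<close>

lemma conic_through_small:
  assumes "X \<subseteq> pg2_points" "X \<subseteq> {P1, Q1, P2, Q2}"
    and "P1 \<in> pg2_points" "Q1 \<in> pg2_points" "P1 \<noteq> Q1"
    and "P2 \<in> pg2_points" "Q2 \<in> pg2_points" "P2 \<noteq> Q2"
  shows "\<exists>K. is_conic K \<and> X \<subseteq> K"
proof -
  obtain l m where l: "l \<noteq> 0" "P1 \<in> kernel_points l" "Q1 \<in> kernel_points l"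
    and m: "m \<noteq> 0" "P2 \<in> kernel_points m" "Q2 \<in> kernel_points m"
    using assms two_points_line by metis
  obtain w where "lin_form l w \<noteq> 0" "lin_form m w \<noteq> 0"
    using lin_forms_common_nonzero l(1) m(1) by blast
  then show ?thesis
  proof (intro conic_through[where s = 1 and t = 0 and ?l1.0 = l and ?l2.0 = m and ?m1.0 = l and ?m2.0 = m and w = w])
    fix P assume "P \<in> X"
    then have "P \<in> pg2_points" "P \<in> kernel_points l \<or> P \<in> kernel_points m"
      using assms l m by auto
    moreover obtain v where "v \<in> P" "v \<noteq> 0"
      using \<open>P \<in> pg2_points\<close> pg2_point_nonzero by blast
    ultimately show "P \<in> pg2_points \<and> (\<exists>v\<in>P. v \<noteq> 0 \<and>
        1 * (lin_form l v * lin_form m v) + 0 * (lin_form l v * lin_form m v) = 0)"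
      by (auto simp: kernel_points_def)
  qed simp
qed

theorem theorem3:
  fixes A B C :: "'a::field pg2_point set" and n :: nat
  assumes "dual_3_net n A B C"
    and "CHAR('a) > 0 \<longrightarrow> n \<le> CHAR('a)"
    and "\<exists>l \<in> pg2_lines. C \<subseteq> l"
  shows "\<exists>K. is_conic K \<and> A \<union> B \<subseteq> K"
proof -
  have pts: "A \<subseteq> pg2_points" "B \<subseteq> pg2_points" "C \<subseteq> pg2_points"
    and disj: "A \<inter> B = {}" "A \<inter> C = {}" "B \<inter> C = {}"
    and fin: "finite A" "finite B" "finite C"
    and card: "card A = n" "card B = n" "card C = n"
    using assms(1) by (auto simp: dual_3_net_def)
  consider "n = 0" | "n = 1 \<or> n = 2" | "n \<ge> 3" by linarith
  then show ?thesis
  proof cases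
    case 1
    \<comment> \<open>Nothing has to be covered, but a conic must exist; a double line will
      do.\<close>
    have "is_conic {P \<in> pg2_points. \<forall>v\<in>P. quadratic_form (1::'a) 0 0 0 0 0 v = 0}"
      unfolding is_conic_def by (intro exI[of _ 1] exI[of _ 0] conjI refl) simp
    then show ?thesis using 1 card fin by auto
  next
    case 2
    \<comment> \<open>The two points may coincide, so that order 1 is treated together with order
      2.\<close>
    have pair: "\<exists>P Q. X = {P, Q}" if "card X = n" for X :: "'a pg2_point set"
      using that 2 card_1_singletonE[of X] card_2_iff[of X] by (metis insert_absorb2)
    obtain P1 P2 Q1 Q2 where PQ: "A = {P1, P2}" "B = {Q1, Q2}"
      using pair card by metis
    show ?thesis
      using pts disj(1) by (intro conic_through_small[of _ P1 Q1 P2 Q2]) (auto simp: PQ)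
  next
    case 3
    then have n: "n \<noteq> 0" "3 \<le> n" by simp_all
    note line = dual_3_net_line[OF assms(1)]
    obtain l where l: "l \<noteq> 0" "C \<subseteq> kernel_points l"
      using assms(3) line_kernel_points by metis
    \<comment> \<open>Otherwise \<open>l\<close> would meet two components and hence contain just
      one point of \<open>C\<close>, but it contains all \<open>n \<ge> 3\<close> of them.\<close>
    have off: "P \<notin> kernel_points l" if P: "P \<in> A \<union> B" for P
    proof
      assume "P \<in> kernel_points l"
      moreover obtain c where "c \<in> C" using card(3) n by fastforce
      moreover have "B \<inter> C = {}" "A \<inter> C = {}" using disj by auto
      ultimately have "\<exists>!R. R \<in> C \<and> R \<in> kernel_points l"
        using line[OF l(1), of A C C P c] line[OF l(1), of B C C P c] P l(2) by auto
      then obtain R where "C = {R}"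
        using l(2) by auto
      then show False using card(3) n by simp
    qed
    define rep where "rep P = (SOME v. v \<in> P \<and> v \<noteq> 0)" for P :: "'a pg2_point"
    have "rep P \<in> P \<and> rep P \<noteq> 0" if "P \<in> pg2_points" for P
      unfolding rep_def by (rule someI_ex) (use pg2_point_nonzero[OF that] in blast)
    then have rep: "rep P \<in> P" "rep P \<noteq> 0" if "P \<in> pg2_points" for P
      using that by blast+
    \<comment> \<open>Scaling \<open>l\<close> to the value 1 gives affine coordinates with
      \<open>l\<close> at infinity.\<close>
    define r where "r P = (1 / lin_form l (rep P)) *s rep P" for P
    have r: "r P \<in> P" "r P \<noteq> 0" "lin_form l (r P) = 1" "P \<in> pg2_points" if P: "P \<in> A \<union> B" for P
    proof -
      show P': "P \<in> pg2_points" using P pts by auto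
      have "lin_form l (rep P) \<noteq> 0"
        using off[OF P] mem_kernel_points_iff[OF P' rep[OF P']] by simp
      then show "lin_form l (r P) = 1"
        by (simp add: r_def lin_form_scale)
      then show "r P \<noteq> 0" using lin_form_0[of l] by fastforce
      show "r P \<in> P"
        using P' rep[OF P'] by (auto simp: r_def pg2_points_def vec.subspace_scale)
    qed

    \<comment> \<open>Affine coordinates and directions\<close>
    have onl: "P \<in> kernel_points m \<longleftrightarrow> lin_form m (r P) = 0" if "P \<in> A \<union> B" for P m
      using mem_kernel_points_iff r[OF that] by blast
    obtain i j k where piv: "l $ i \<noteq> 0" "(UNIV :: 3 set) = {i, j, k}" "i \<noteq> j" "i \<noteq> k" "j \<noteq> k"
      using pivot_exists[OF l(1)] by metis
    note form = lin_form_pivot[OF piv(2-5)]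
    define x y where "x P = r P $ j" and "y P = r P $ k" for P
    \<comment> \<open>The pair \<open>(s c, t c)\<close> is normal to the direction of
      \<open>c\<close>, so \<open>s c * x + t c * y\<close> is constant on the affine lines through
      \<open>c\<close>.\<close>
    define s t where "s c = rep c $ k" and "t c = - (rep c $ j)" for c
    have C: "lin_form l (rep c) = 0" "rep c \<in> c" "rep c \<noteq> 0" "c \<in> pg2_points" if "c \<in> C" for c
      using that pts l(2) rep[of c] mem_kernel_points_iff[of c "rep c" l] by auto
    \<comment> \<open>As \<open>c\<close> lies on \<open>l\<close>, its pivot coordinate follows
      from the other two; hence \<open>(s c, t c)\<close> determines \<open>c\<close>.\<close>
    have Ci: "rep c $ i = - (l $ j * rep c $ j + l $ k * rep c $ k) / l $ i" if "c \<in> C" for c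
    proof -
      have "l $ i * rep c $ i = - (l $ j * rep c $ j + l $ k * rep c $ k)"
        using C(1)[OF that] unfolding form add.assoc by (simp only: eq_neg_iff_add_eq_0)
      then show ?thesis using piv(1) by (metis nonzero_mult_div_cancel_left)
    qed
    have vec_eqI: "v = w" if "v $ i = w $ i" "v $ j = w $ j" "v $ k = w $ k" for v w :: "'a ^ 3"
    proof -
      have "v $ m = w $ m" for m
      proof -
        have "m \<in> {i, j, k}" using piv(2) UNIV_I[of m] by simp
        then show ?thesis using that by blast
      qed
      then show ?thesis by (simp add: vec_eq_iff)
    qed
    have nz: "s c \<noteq> 0 \<or> t c \<noteq> 0" if "c \<in> C" for c
      using C(3)[OF that] Ci[OF that] vec_eqI[of "rep c" 0] by (auto simp: s_def t_def)
    have np: "s c * t e \<noteq> s e * t c" if "c \<in> C" "e \<in> C" "c \<noteq> e" for c e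
    proof
      assume eq: "s c * t e = s e * t c"
      define d where "d = (if t c \<noteq> 0 then t e / t c else s e / s c)"
      have "s e = d * s c" "t e = d * t c"
        using eq nz[OF that(1)] by (auto simp: d_def field_simps)
      then have "rep e = d *s rep c"
        by (intro vec_eqI) (simp_all add: Ci that s_def t_def algebra_simps add_divide_distrib diff_divide_distrib)
      then show False
        using pg2_points_eqI[of c "rep c" e "rep e" d] C that by blast
    qed

    \<comment> \<open>Projection from the points of \<open>C\<close>\<close>
    define u where "u c P = s c * x P + t c * y P" for c P
    \<comment> \<open>The line through \<^term>\<open>c\<close> on which the projection from \<^term>\<open>c\<close> takes the value \<^term>\<open>z\<close>.\<close>
    define pencil :: "'a pg2_point \<Rightarrow> 'a \<Rightarrow> 'a ^ 3" where
      "pencil c z = (\<chi> m. (if m = j then s c else if m = k then t c else 0) - z * l $ m)" for c z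
    have pencil: "lin_form (pencil c z) v = s c * v $ j + t c * v $ k - z * lin_form l v" for c z v
      using piv(3-5) by (simp add: form pencil_def algebra_simps)
    have pencil_nz: "pencil c z \<noteq> 0" if "c \<in> C" for c z
    proof
      assume "pencil c z = 0"
      then have *: "pencil c z $ m = 0" for m by simp
      have "z = 0" using *[of i] piv by (simp add: pencil_def)
      then show False using *[of j] *[of k] piv nz[OF that] by (simp add: pencil_def)
    qed
    have pencil_C: "c \<in> kernel_points (pencil c z)" if "c \<in> C" for c z
      using mem_kernel_points_iff[of c "rep c" "pencil c z"] C[OF that]
      by (simp add: pencil s_def t_def)
    have pencil_AB: "P \<in> kernel_points (pencil c z) \<longleftrightarrow> u c P = z" if "P \<in> A \<union> B" for c z P
      using onl[OF that] r(3)[OF that] by (simp add: pencil u_def x_def y_def)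
    \<comment> \<open>The line joining \<open>c\<close> and \<open>P\<close> meets two components,
      so it contains exactly one point of \<open>Z\<close>. The case \<open>X = Z\<close> will give
      injectivity of \<open>u c\<close>, the other case equality of images.\<close>
    have fibre: "\<exists>!R. R \<in> Z \<and> u c R = u c P"
      if "c \<in> C" "X \<in> {A, B}" "Z \<in> {A, B}" "P \<in> X" for c X Z P
    proof -
      have "\<exists>!R. R \<in> Z \<and> R \<in> kernel_points (pencil c (u c P))"
        by (rule line[of _ X C Z P c])
          (use that disj pencil_nz pencil_C pencil_AB in auto)
      moreover have "R \<in> kernel_points (pencil c (u c P)) \<longleftrightarrow> u c R = u c P" if "R \<in> Z" for R
        using pencil_AB[of R] that \<open>Z \<in> {A, B}\<close> by auto
      ultimately show ?thesis by metis
    qed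
    have proj: "(\<Sum>P\<in>A. (s c * x P + t c * y P) ^ d) = (\<Sum>P\<in>B. (s c * x P + t c * y P) ^ d)"
      if c: "c \<in> C" for c d
    proof -
      have inj: "inj_on (u c) X" if "X \<in> {A, B}" for X
        using fibre[OF c that that] by (metis inj_onI)
      have "u c ` X \<subseteq> u c ` Y" if "X \<in> {A, B}" "Y \<in> {A, B}" for X Y
      proof
        fix z assume "z \<in> u c ` X"
        then obtain P where "P \<in> X" "z = u c P" by blast
        then show "z \<in> u c ` Y"
          using fibre[OF c that, of P] by (metis imageI)
      qed
      then have "u c ` A = u c ` B" by (simp add: subset_antisym)
      then show ?thesis
        using sum_image_eq[of "u c" A B "\<lambda>z. z ^ d"] inj by (simp add: u_def)
    qed
    \<comment> \<open>The degree \<open>a + b < n\<close> is below the number \<open>n\<close> of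
      projection centres and below the characteristic, if that is positive.\<close>
    interpret balanced_pair A B x y n
    proof
      fix a b :: nat assume ab: "a + b < n"
      have "(\<Sum>P\<in>A. x P ^ a * y P ^ (a + b - a)) = (\<Sum>P\<in>B. x P ^ a * y P ^ (a + b - a))"
        by (rule moments_eq[of C "a + b" s t]) (use fin card ab nz np proj assms(2) in auto)
      then show "(\<Sum>P\<in>A. x P ^ a * y P ^ b) = (\<Sum>P\<in>B. x P ^ a * y P ^ b)" by simp
    qed (use fin card disj in auto)
    \<comment> \<open>Eliminating the pivot coordinate by \<open>lin_form l (r P) = 1\<close> makes
      every linear form affine in \<open>x\<close> and \<open>y\<close>.\<close>
    have affine: "affine_fun (\<lambda>P. lin_form m (r P))" for m
    proof -
      have "lin_form m (r P) = (m $ j - m $ i * l $ j / l $ i) * x P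
          + (m $ k - m $ i * l $ k / l $ i) * y P + m $ i / l $ i" if "P \<in> A \<union> B" for P
      proof -
        have "l $ i * r P $ i = 1 - l $ j * x P - l $ k * y P"
          using r(3)[OF that] by (simp add: form x_def y_def algebra_simps)
        then have "r P $ i = (1 - l $ j * x P - l $ k * y P) / l $ i"
          using piv(1) by (simp add: field_simps)
        then have "lin_form m (r P) =
            m $ i * ((1 - l $ j * x P - l $ k * y P) / l $ i) + m $ j * x P + m $ k * y P"
          by (simp only: form x_def y_def)
        also have "\<dots> = (m $ j - m $ i * l $ j / l $ i) * x P
          + (m $ k - m $ i * l $ k / l $ i) * y P + m $ i / l $ i"
          by (simp add: algebra_simps diff_divide_distrib add_divide_distrib)
        finally show ?thesis .
      qed
      then have "\<forall>P\<in>A \<union> B. lin_form m (r P) = (m $ j - m $ i * l $ j / l $ i) * x P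
          + (m $ k - m $ i * l $ k / l $ i) * y P + m $ i / l $ i" ..
      then show ?thesis unfolding affine_fun_def by (intro exI)
    qed

    \<comment> \<open>Joining lines and the conic\<close>
    define J where "J P Q = cross_prod (r P) (r Q)" for P Q
    have J0: "lin_form (J a b) (r P) = 0 \<longleftrightarrow> P = a \<or> P = b"
      if "a \<in> A" "b \<in> B" "P \<in> A \<union> B" for a b P
    proof
      have ab: "lin_form (J a b) (r a) = 0" "lin_form (J a b) (r b) = 0"
        by (simp_all add: J_def lin_form_cross_prod)
      then show "lin_form (J a b) (r P) = 0" if "P = a \<or> P = b" using that by auto
      assume P: "lin_form (J a b) (r P) = 0"
      have "J a b \<noteq> 0"
        unfolding J_def by (rule cross_prod_points[of a _ b]) (use that disj(1) r in auto)
      then have "\<exists>!R. R \<in> Z \<and> R \<in> kernel_points (J a b)" if "Z \<in> {A, B}" for Z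
        using that disj(1) ab \<open>a \<in> A\<close> \<open>b \<in> B\<close> onl[of a] onl[of b]
        by (intro line[of _ A B Z a b]) auto
      then have "\<exists>!R. R \<in> A \<and> R \<in> kernel_points (J a b)" "\<exists>!R. R \<in> B \<and> R \<in> kernel_points (J a b)"
        by simp_all
      moreover have "P \<in> kernel_points (J a b)" "a \<in> kernel_points (J a b)" "b \<in> kernel_points (J a b)"
        using P ab that by (simp_all add: onl)
      ultimately show "P = a \<or> P = b"
        using that by (metis Un_iff)
    qed
    have join: "affine_fun (\<lambda>P. lin_form (J a b) (r P)) \<and>
        (\<forall>P\<in>A \<union> B. lin_form (J a b) (r P) = 0 \<longleftrightarrow> P = a \<or> P = b)" if "a \<in> A" "b \<in> B" for a b
      using affine J0[OF that] by blast
    obtain a1 a2 b1 b2 \<alpha> \<beta> where ab: "a1 \<in> A" "a2 \<in> A" "a1 \<noteq> a2" "b1 \<in> B" "b2 \<in> B" "b1 \<noteq> b2"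
      and "\<beta> \<noteq> 0"
      and zero: "\<And>P. P \<in> A \<union> B \<Longrightarrow> \<alpha> * (lin_form (J a1 b1) (r P) * lin_form (J a2 b2) (r P))
        + \<beta> * (lin_form (J a1 b2) (r P) * lin_form (J a2 b1) (r P)) = 0"
      by (rule conic_covers[of "\<lambda>a b P. lin_form (J a b) (r P)", OF join n(2)]) (assumption | rule that)+
    have ne: "P \<noteq> Q" if "P \<in> A" "Q \<in> B" for P Q
      using that disj(1) by blast
    have J_ends: "lin_form (J a b) (r a) = 0" "lin_form (J a b) (r b) = 0" for a b
      by (simp_all add: J_def lin_form_cross_prod)
    \<comment> \<open>The vector \<open>r a1 + r b1\<close> witnesses that the quadratic form is
      nonzero: it lies on the line \<open>a1 b1\<close> but on neither line of the second pair, and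
      \<beta> is nonzero.\<close>
    have "lin_form (J a1 b2) (r b1) \<noteq> 0" "lin_form (J a2 b1) (r a1) \<noteq> 0"
      using ab ne[OF ab(1,4)] J0[of a1 b2 b1] J0[of a2 b1 a1] by simp_all
    then have "lin_form (J a1 b1) (r a1 + r b1) = 0" "lin_form (J a1 b2) (r a1 + r b1) \<noteq> 0"
      "lin_form (J a2 b1) (r a1 + r b1) \<noteq> 0"
      by (simp_all add: lin_form_add J_ends)
    then have "\<alpha> * (lin_form (J a1 b1) (r a1 + r b1) * lin_form (J a2 b2) (r a1 + r b1))
        + \<beta> * (lin_form (J a1 b2) (r a1 + r b1) * lin_form (J a2 b1) (r a1 + r b1)) \<noteq> 0"
      using \<open>\<beta> \<noteq> 0\<close> by simp
    then show ?thesis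
    proof (rule conic_through)
      fix P assume "P \<in> A \<union> B"
      then show "P \<in> pg2_points \<and> (\<exists>v\<in>P. v \<noteq> 0 \<and>
          \<alpha> * (lin_form (J a1 b1) v * lin_form (J a2 b2) v)
          + \<beta> * (lin_form (J a1 b2) v * lin_form (J a2 b1) v) = 0)"
        using r[of P] zero[of P] by blast
    qed
  qed
qed

end
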